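(* Let $n$ be a positive integer and let $P_1, P_2, \ldots, P_n \in \mathbb{Z}[x]$ be arbitrary. Then there exists a polynomial $D \in \mathbb{Z}[x]$ such that $$S(D) = S(P_1) \cap S(P_2) \cap \cdots \cap S(P_n).$$
   Context: For $P \in \mathbb{Z}[x]$, $S(P)$ denotes the set of prime divisors of $P$, i.e. the set of primes $p$ such that $p \mid P(m)$ for some integer $m$. *)

theory Defs
  imports "HOL-Computational_Algebra.Computational_Algebra"
begin

definition prime_divisors :: "int poly \<Rightarrow> nat set" where
  "prime_divisors P = {p. prime p \<and> (\<exists>m::int. int p dvd poly P m)}"

end

theory Submission
  imports Defs
begin

text \<open>
  Write S(P) for the set of prime divisors of P. Since S(P Q) is the union of S(P) and S(Q),
  it suffices to intersect S(P) and S(Q) for two prime elements P, Q of the ring of integer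
  polynomials, and a set that agrees with some S(D) up to finitely many primes is again of this
  form. If one of P, Q is constant, the intersection is finite. Otherwise P and Q have simple
  complex roots; choose an integer k such that the numbers a + k b are distinct for distinct pairs
  (a, b) of a root of P and a root of Q, and let D be an integer polynomial of minimal degree
  vanishing at all a + k b. Then D(x + k y) lies in the ideal generated by P(x) and Q(y) over the
  rationals, so roots s of P and t of Q modulo p give the root s + k t of D for almost all p.
  Conversely there are rational polynomials f, g with f(a + k b) = a and g(a + k b) = b, so D
  divides P o f and Q o g, and a root of D modulo p is mapped to roots of P and Q for almost all p.
  Such f and g exist over the complex numbers by interpolation; a linear functional from the
  complex to the rational numbers, applied to the coefficients, makes them rational.
\<close>

section \<open>Finite modifications of sets of prime divisors\<close>

lemma prime_divisors_mult: "prime_divisors (P * Q) = prime_divisors P \<union> prime_divisors Q"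
  unfolding prime_divisors_def by (auto simp: prime_dvd_mult_iff)

lemma prime_divisors_0: "prime_divisors 0 = {p. prime p}"
  unfolding prime_divisors_def by auto

lemma prime_divisors_linear: "prime_divisors [:0, 1:] = {p. prime p}"
  unfolding prime_divisors_def by (auto intro!: exI[of _ 0])

lemma prime_divisors_const: "prime_divisors [:c:] = {p. prime p \<and> int p dvd c}"
  unfolding prime_divisors_def by auto

lemma finite_prime_divisors_const:
  assumes "c \<noteq> 0"
  shows "finite {p. prime p \<and> int p dvd c}"
proof -
  have "{p. prime p \<and> int p dvd c} \<subseteq> {p. p dvd nat \<bar>c\<bar>}"
    by (auto simp: nat_dvd_iff int_dvd_int_iff)
  then show ?thesis
    using \<open>c \<noteq> 0\<close> finite_divisors_nat[of "nat \<bar>c\<bar>"] by (auto intro: finite_subset)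
qed

lemma dvd_poly_cong:
  fixes P :: "int poly"
  assumes "d dvd x - y"
  shows "d dvd poly P x \<longleftrightarrow> d dvd poly P y"
proof -
  have "d dvd poly P x - poly P y"
  proof (induction P)
    case (pCons a P)
    have "poly (pCons a P) x - poly (pCons a P) y
        = x * (poly P x - poly P y) + (x - y) * poly P y"
      by (simp add: algebra_simps)
    then show ?case using pCons assms by simp
  qed simp
  then show ?thesis
    by (metis dvd_diff_right_iff dvd_diff_left_iff)
qed

lemma prime_divisors_pcompose_shift: "prime_divisors (pcompose D [:a, 1:]) = prime_divisors D"
proof -
  have "(\<exists>m. d dvd poly D (a + m)) \<longleftrightarrow> (\<exists>m. d dvd poly D m)" for d
    by (metis add.commute diff_add_cancel)
  then show ?thesis unfolding prime_divisors_def by (simp add: poly_pcompose)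
qed

lemma linear_congruence_solvable:
  assumes "prime p" "\<not> int p dvd N"
  obtains x where "int p dvd N * x - u"
proof -
  have "coprime (int p) N"
    using assms by (simp add: prime_imp_coprime)
  then obtain r s where "r * int p + s * N = 1"
    using bezout_int[of "int p" N] by (metis coprime_imp_gcd_eq_1)
  then have "N * (s * u) - u = int p * (- r * u)"
    by algebra
  then show ?thesis by (intro that[of "s * u"]) simp
qed

text \<open>The polynomial on the left is D(N d x) / d for D = pCons d E; it is 1 modulo N.\<close>
lemma prime_divisors_remove:
  assumes "d \<noteq> 0" "d dvd N"
  shows "prime_divisors (1 + [:0, N:] * pcompose E [:0, N * d:])
       = {p \<in> prime_divisors (pCons d E). \<not> int p dvd N}" (is "prime_divisors ?D = _")
proof -
  have eq: "d * poly ?D m = poly (pCons d E) (N * d * m)" for m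
    by (simp add: poly_pcompose algebra_simps)
  have one: "\<not> int p dvd poly ?D m" if "prime p" "int p dvd N" for p m
  proof
    assume dv: "int p dvd poly ?D m"
    have "int p dvd 1"
      using dv \<open>int p dvd N\<close> by (simp add: poly_pcompose dvd_add_left_iff)
    then show False using \<open>prime p\<close> by (simp add: prime_gt_1_nat)
  qed
  \<comment> \<open>Solving \<open>N * d * x = m\<close> modulo \<open>p\<close> carries a root
    \<open>m\<close> of \<open>pCons d E\<close> to a root of the new polynomial.\<close>
  have lift: "\<exists>x. int p dvd poly ?D x"
    if p: "prime p" "\<not> int p dvd N" and m: "int p dvd poly (pCons d E) m" for p m
  proof -
    have nd: "\<not> int p dvd d" using p assms by (meson dvd_trans)
    then have "\<not> int p dvd N * d" using p by (simp add: prime_dvd_mult_iff)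
    then obtain x where "int p dvd N * d * x - m"
      using linear_congruence_solvable[OF p(1)] by metis
    then have "int p dvd d * poly ?D x"
      unfolding eq using m dvd_poly_cong by blast
    then show ?thesis using nd p(1) prime_dvd_multD[of "int p"] by auto
  qed
  show ?thesis
    unfolding prime_divisors_def
    using one lift eq by (auto simp del: poly_add poly_mult poly_pCons) (metis dvd_mult)
qed

text \<open>Take \<open>N\<close> divisible by all exceptional primes, strip every prime dividing
  \<open>N\<close>, and put back those lying in \<open>T\<close> through a constant factor, which
  contributes exactly its own prime divisors.\<close>

lemma prime_divisors_finite_modification:
  assumes T: "T \<subseteq> {p. prime p}"
    and fin: "finite {p. \<not> (p \<in> prime_divisors D \<longleftrightarrow> p \<in> T)}"
  obtains D' where "prime_divisors D' = T"
proof -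
  \<comment> \<open>The zero polynomial has all primes as prime divisors, and so does
    \<open>[:0, 1:]\<close>, which can replace it.\<close>
  have "\<exists>D0. D0 \<noteq> 0 \<and> prime_divisors D0 = prime_divisors D"
  proof (cases "D = 0")
    case True
    then show ?thesis
      by (intro exI[of _ "[:0, 1:]"]) (simp add: prime_divisors_0 prime_divisors_linear)
  qed blast
  then obtain D0 where D0: "D0 \<noteq> 0" "prime_divisors D0 = prime_divisors D" by blast
  have "\<not> (\<forall>x. poly D0 x = 0)" using D0 poly_all_0_iff_0 by blast
  then obtain a where a: "poly D0 a \<noteq> 0" by blast
  \<comment> \<open>Moving a non-root to the origin makes the constant coefficient \<open>d\<close>
    nonzero without changing the set of prime divisors.\<close>
  define D1 where "D1 = pcompose D0 [:a, 1:]"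
  obtain d E where dE: "D1 = pCons d E" by (rule pCons_cases)
  have "poly D1 0 \<noteq> 0" using a by (simp add: D1_def poly_pcompose)
  then have d: "d \<noteq> 0" by (simp add: dE)
  have S1: "prime_divisors (pCons d E) = prime_divisors D"
    using D0 prime_divisors_pcompose_shift by (simp add: D1_def flip: dE)
  define X where "X = {p. \<not> (p \<in> prime_divisors D \<longleftrightarrow> p \<in> T)}"
  have Xpos: "p \<noteq> 0" if "p \<in> X" for p
    using that T by (auto simp: X_def prime_divisors_def intro!: prime_gt_0_nat)
  \<comment> \<open>The factor \<open>d\<close> secures \<open>d dvd N\<close>, as
    \<open>prime_divisors_remove\<close> requires; the product covers the exceptional
    primes.\<close>
  define N where "N = d * int (\<Prod>X)"
  have N: "N \<noteq> 0" using d Xpos fin by (auto simp: N_def X_def)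
  have XN: "int p dvd N" if "p \<in> X" for p
    using that fin by (auto simp: N_def X_def int_dvd_int_iff intro!: dvd_mult dvd_prodI)
  define Y where "Y = {p \<in> T. int p dvd N}"
  have Y: "finite Y" "\<And>p. p \<in> Y \<Longrightarrow> prime p"
    using finite_prime_divisors_const[OF N] T by (auto simp: Y_def elim!: finite_subset[rotated])
  have SY: "prime_divisors [:int (\<Prod>Y):] = Y"
  proof -
    have "p dvd \<Prod>Y \<longleftrightarrow> p \<in> Y" if "prime p" for p
      using Y that primes_dvd_imp_eq[of p] by (auto simp: prime_dvd_prod_iff intro: bexI[of _ p])
    then show ?thesis using Y by (auto simp: prime_divisors_const int_dvd_int_iff simp del: of_nat_prod)
  qed
  have "prime_divisors ((1 + [:0, N:] * pcompose E [:0, N * d:]) * [:int (\<Prod>Y):]) = T"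
    unfolding prime_divisors_mult SY
    by (subst prime_divisors_remove) (use d S1 XN in \<open>auto simp: N_def Y_def X_def\<close>)
  then show ?thesis using that by blast
qed

section \<open>Rational polynomials and complex roots\<close>

text \<open>A constant of its own, so that the simp rules below treat evaluation as a ring
  homomorphism without exposing \<open>map_poly of_rat\<close>.\<close>

definition rat_poly_eval :: "rat poly \<Rightarrow> complex \<Rightarrow> complex" where
  "rat_poly_eval h z = poly (map_poly of_rat h) z"

lemma rat_poly_eval_0 [simp]: "rat_poly_eval 0 z = 0"
  by (simp add: rat_poly_eval_def)

lemma rat_poly_eval_pCons [simp]:
  "rat_poly_eval (pCons a h) z = of_rat a + z * rat_poly_eval h z"
  by (simp add: rat_poly_eval_def map_poly_pCons)

lemma rat_poly_eval_add [simp]: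
  "rat_poly_eval (f + g) z = rat_poly_eval f z + rat_poly_eval g z"
proof (induction f arbitrary: g)
  case (pCons a f)
  then show ?case by (cases g) (simp add: of_rat_add algebra_simps)
qed simp

lemma rat_poly_eval_smult [simp]: "rat_poly_eval (smult c f) z = of_rat c * rat_poly_eval f z"
  by (induction f) (simp_all add: of_rat_mult algebra_simps)

lemma rat_poly_eval_mult [simp]:
  "rat_poly_eval (f * g) z = rat_poly_eval f z * rat_poly_eval g z"
  by (induction f) (simp_all add: algebra_simps)

lemma rat_poly_eval_pcompose [simp]:
  "rat_poly_eval (pcompose f g) z = rat_poly_eval f (rat_poly_eval g z)"
  by (induction f) (simp_all add: pcompose_pCons)

lemma rat_poly_eval_of_int_poly [simp]:
  "rat_poly_eval (map_poly of_int P) z = poly (map_poly of_int P) z"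
  by (induction P) (simp_all add: map_poly_pCons)

lemma rat_poly_eval_altdef:
  assumes "degree h < m"
  shows "rat_poly_eval h z = (\<Sum>i<m. of_rat (coeff h i) * z ^ i)"
proof -
  have "rat_poly_eval h z = (\<Sum>i\<le>degree (map_poly of_rat h :: complex poly). of_rat (coeff h i) * z ^ i)"
    by (simp add: rat_poly_eval_def poly_altdef coeff_map_poly)
  also have "\<dots> = (\<Sum>i<m. of_rat (coeff h i) * z ^ i)"
    using assms by (intro sum.mono_neutral_left) (auto simp: degree_map_poly coeff_eq_0)
  finally show ?thesis .
qed

lemma rat_poly_eval_monom [simp]: "rat_poly_eval (monom 1 n) z = z ^ n"
  by (simp add: rat_poly_eval_def map_poly_monom poly_monom)

section \<open>Integer polynomials read over other rings, and clearing of denominators\<close>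

lemma poly_of_int_poly_of_int:
  "poly (map_poly of_int P) (of_int x :: 'a :: comm_ring_1) = of_int (poly P x)"
  by (induction P) (simp_all add: map_poly_pCons)

lemma of_int_poly_mult:
  "map_poly (of_int :: int \<Rightarrow> 'a :: comm_ring_1) (P * Q) = map_poly of_int P * map_poly of_int Q"
  by (intro poly_eqI) (simp add: coeff_map_poly coeff_mult)

lemma of_int_poly_add:
  "map_poly (of_int :: int \<Rightarrow> 'a :: comm_ring_1) (P + Q) = map_poly of_int P + map_poly of_int Q"
  by (intro poly_eqI) (simp add: coeff_map_poly)

lemma of_int_poly_smult:
  "map_poly (of_int :: int \<Rightarrow> 'a :: comm_ring_1) (smult c P) = smult (of_int c) (map_poly of_int P)"
  by (intro poly_eqI) (simp add: coeff_map_poly)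

lemma of_int_poly_pderiv:
  "map_poly (of_int :: int \<Rightarrow> 'a :: idom) (pderiv P) = pderiv (map_poly of_int P)"
  by (intro poly_eqI) (simp add: coeff_map_poly coeff_pderiv)

lemma rat_poly_clear_denominators:
  obtains N :: int and F :: "int poly"
  where "N \<noteq> 0" "smult (of_int N) h = map_poly (of_int :: int \<Rightarrow> rat) F"
proof -
  have "\<exists>N F. N \<noteq> 0 \<and> smult (of_int N) h = map_poly (of_int :: int \<Rightarrow> rat) F"
  proof (induction h)
    case 0
    show ?case by (intro exI[of _ 1] exI[of _ 0]) simp
  next
    case (pCons a h)
    then obtain N F where N: "N \<noteq> 0" and F: "smult (of_int N) h = map_poly (of_int :: int \<Rightarrow> rat) F"
      by blast
    obtain u v :: int where uv: "quotient_of a = (u, v)" by (cases "quotient_of a")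
    then have v: "v > 0" and a: "a = of_int u / of_int v"
      using quotient_of_denom_pos quotient_of_div by auto
    have "smult (of_int (N * v)) (pCons a h) = pCons (of_int (N * u)) (smult (of_int v) (smult (of_int N) h))"
      using v a by (simp add: mult.commute)
    also have "\<dots> = map_poly of_int (pCons (N * u) (smult v F))"
      unfolding F by (simp add: map_poly_pCons of_int_poly_smult)
    finally show ?case using N v by (intro exI[of _ "N * v"] exI[of _ "pCons (N * u) (smult v F)"]) auto
  qed
  then show ?thesis using that by blast
qed

text \<open>In characteristic zero a prime polynomial of positive degree shares no root with its
  derivative, so it is squarefree over the complex numbers. The exact count makes the monomials
  independent on the grid of root pairs.\<close>

lemma card_complex_roots_prime_poly:
  fixes P :: "int poly"
  assumes "prime_elem P" "degree P > 0"
  shows "card {z :: complex. poly (map_poly of_int P) z = 0} = degree P"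
proof -
  let ?r = "\<lambda>R z. poly (map_poly of_int R) z :: complex"
  \<comment> \<open>A minimal polynomial M of a double root would be a multiple of P of degree below deg P.\<close>
  have simple: "\<not> (?r P z = 0 \<and> ?r (pderiv P) z = 0)" for z
  proof
    assume z: "?r P z = 0 \<and> ?r (pderiv P) z = 0"
    have nz: "pderiv P \<noteq> 0" using assms by (simp add: pderiv_eq_0_iff)
    obtain M where M: "M \<noteq> 0" "?r M z = 0"
      and least: "\<And>R. R \<noteq> 0 \<Longrightarrow> ?r R z = 0 \<Longrightarrow> degree M \<le> degree R"
      using ex_has_least_nat[of "\<lambda>R. R \<noteq> 0 \<and> ?r R z = 0" "pderiv P" degree] nz z by blast
    \<comment> \<open>Pseudo-division, since the integers are not a field; the remainder vanishes at
      \<open>z\<close>, so it is zero by minimality of \<open>M\<close>.\<close>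
    obtain c q where c: "c \<noteq> 0" "smult c P = M * q + pseudo_mod P M"
      using pseudo_mod(1)[OF M(1)] by blast
    have "?r (smult c P) z = ?r (M * q + pseudo_mod P M) z" using c by simp
    then have "?r (pseudo_mod P M) z = 0"
      using z M by (simp add: of_int_poly_smult of_int_poly_add of_int_poly_mult)
    then have "pseudo_mod P M = 0"
      using least pseudo_mod(2)[OF M(1), of P] by (meson leD)
    then have Mq: "smult c P = M * q" using c by simp
    \<comment> \<open>This gives \<open>degree q < degree P\<close>, which excludes that
      \<open>P\<close> divides \<open>q\<close>.\<close>
    have dM: "degree M > 0"
    proof (rule ccontr)
      assume "\<not> degree M > 0"
      then obtain e where "M = [:e:]" by (metis not_gr_zero degree_eq_zeroE)
      then show False using M by (simp add: map_poly_pCons)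
    qed
    have qnz: "q \<noteq> 0" using Mq c assms by auto
    have deg: "degree P = degree M + degree q"
      using Mq c M qnz by (metis degree_mult_eq degree_smult_eq)
    have "P dvd M * q" by (metis Mq dvd_smult dvd_refl)
    then have "P dvd M \<or> P dvd q" using assms prime_elem_dvd_multD by blast
    then have "degree P \<le> degree M"
      using dvd_imp_degree_le[of P q] qnz dM deg dvd_imp_degree_le[of P M] M by auto
    moreover have "degree M \<le> degree (pderiv P)" using least nz z by blast
    ultimately show False using assms by (simp add: degree_pderiv)
  qed
  define p where "p = (map_poly of_int P :: complex poly)"
  have "rsquarefree p" unfolding rsquarefree_roots p_def using simple by (simp add: of_int_poly_pderiv)
  have pnz: "p \<noteq> 0" using assms by (auto simp: p_def map_poly_eq_0_iff)
  have "degree p = degree (smult (lead_coeff p) (\<Prod>z | poly p z = 0. [:-z, 1:]))"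
    using complex_poly_decompose_rsquarefree[OF \<open>rsquarefree p\<close>] by simp
  also have "\<dots> = card {z. poly p z = 0}"
    using pnz by (simp add: degree_prod_eq_sum_degree)
  finally show ?thesis by (simp add: p_def degree_map_poly)
qed

section \<open>Interpolation, separation of root pairs, and linear algebra over the
  rationals\<close>

text \<open>Newton's scheme: a new point is accommodated by a multiple of the product
  \<open>w\<close> that vanishes at all earlier points.\<close>

lemma interpolation_poly_exists:
  fixes v :: "'a :: field \<Rightarrow> 'a"
  assumes "finite X"
  obtains f where "\<And>x. x \<in> X \<Longrightarrow> poly f x = v x"
proof -
  have "\<exists>f. \<forall>x\<in>X. poly f x = v x"
    using assms
  proof (induction X)
    case (insert y X)
    then obtain f where f: "\<forall>x\<in>X. poly f x = v x" by blast
    define w where "w = (\<Prod>x\<in>X. [:-x, 1:])"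
    have w0: "poly w x = 0" if "x \<in> X" for x
      using that insert by (auto simp: w_def poly_prod intro!: bexI[of _ x])
    have wy: "poly w y \<noteq> 0" using insert by (auto simp: w_def poly_prod)
    show ?case
      by (intro exI[of _ "f + smult ((v y - poly f y) / poly w y) w"]) (use f w0 wy in auto)
  qed simp
  then show ?thesis using that by blast
qed

text \<open>As in the primitive element theorem, a collision of two pairs determines
  \<open>k\<close> as a quotient of differences, so only finitely many \<open>k\<close>
  fail.\<close>

lemma injective_linear_combination:
  fixes A B :: "complex set"
  assumes "finite A" "finite B"
  obtains k :: int where "inj_on (\<lambda>(a, b). a + of_int k * b) (A \<times> B)"
proof -
  \<comment> \<open>Entries with \<open>b = b'\<close> are divisions by zero and only add the value
    0.\<close>
  define X where "X = (\<lambda>((a, a'), (b, b')). (a - a') / (b' - b)) ` ((A \<times> A) \<times> (B \<times> B))"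
  have "finite X" unfolding X_def using assms by (intro finite_imageI finite_cartesian_product)
  moreover have "infinite (range (of_int :: int \<Rightarrow> complex))"
    using finite_imageD[of "of_int :: int \<Rightarrow> complex" UNIV] infinite_UNIV_char_0[where 'a = int]
    by (auto simp: inj_on_def)
  ultimately have "\<not> range (of_int :: int \<Rightarrow> complex) \<subseteq> X"
    using finite_subset by blast
  then obtain k :: int where k: "of_int k \<notin> X" by blast
  have "inj_on (\<lambda>(a, b). a + of_int k * b) (A \<times> B)"
  proof (intro inj_onI, clarify)
    fix a b a' b'
    assume m: "a \<in> A" "b \<in> B" "a' \<in> A" "b' \<in> B"
      and e: "a + of_int k * b = a' + of_int k * b'"
    have "b = b'"
    proof (rule ccontr)
      assume "b \<noteq> b'"
      then have "of_int k = (a - a') / (b' - b)" using e by (simp add: field_simps)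
      then have "of_int k \<in> X"
        unfolding X_def using m by (intro image_eqI[of _ _ "((a, a'), (b, b'))"]) auto
      with k show False by simp
    qed
    with e show "a = a' \<and> b = b'" by simp
  qed
  then show ?thesis using that by blast
qed

text \<open>Over the rationals \<open>{1}\<close> is an independent set of complex numbers, so
  prescribing the value 1 there extends linearly. Such a map fixes every rational, hence turns
  complex solutions of rational linear systems into rational ones.\<close>

lemma rational_functional_exists:
  obtains l :: "complex \<Rightarrow> rat"
  where "\<And>x y. l (x + y) = l x + l y" "\<And>q x. l (of_rat q * x) = q * l x" "l 1 = 1"
proof -
  interpret V: vector_space_pair "\<lambda>(q::rat) (z::complex). of_rat q * z" "(*) :: rat \<Rightarrow> rat \<Rightarrow> rat"
    by unfold_locales (simp_all add: algebra_simps of_rat_add of_rat_mult)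
  have "V.vs1.independent {1}"
    by simp
  then obtain g where g: "Vector_Spaces.linear (\<lambda>(q::rat) (z::complex). of_rat q * z) (*) g" "g 1 = 1"
    using V.linear_independent_extend[of "{1}" "\<lambda>_. 1"] by auto
  then interpret L: Vector_Spaces.linear "\<lambda>(q::rat) (z::complex). of_rat q * z" "(*)" g by simp
  show ?thesis by (rule that[of g]) (simp_all add: L.add L.scale g)
qed

text \<open>The polynomial with coefficients \<open>c i\<close> has degree below \<open>m\<close>
  but \<open>m\<close> roots.\<close>

lemma power_sums_independent:
  fixes c :: "nat \<Rightarrow> complex"
  assumes A: "card A = m" and z: "\<And>a. a \<in> A \<Longrightarrow> (\<Sum>i<m. c i * a ^ i) = 0" and i: "i < m"
  shows "c i = 0"
proof -
  define p where "p = (\<Sum>i<m. monom (c i) i)"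
  have co: "coeff p j = (if j < m then c j else 0)" for j
    by (simp add: p_def coeff_sum if_distrib[of "\<lambda>x. x = _"])
  have "degree p < m"
    using i by (intro degree_lessI) (auto simp: co)
  have "p = 0"
  proof (rule ccontr)
    assume "p \<noteq> 0"
    have "A \<subseteq> {x. poly p x = 0}" using z by (auto simp: p_def poly_sum poly_monom)
    then have "m \<le> card {x. poly p x = 0}"
      unfolding A[symmetric] by (intro card_mono poly_roots_finite \<open>p \<noteq> 0\<close>)
    also have "\<dots> \<le> degree p" by (rule card_poly_roots_bound[OF \<open>p \<noteq> 0\<close>])
    finally show False using \<open>degree p < m\<close> by simp
  qed
  then show ?thesis using co[of i] i by simp
qed

text \<open>Fixing \<open>b\<close> and varying \<open>a\<close> annihilates each coefficient
  polynomial in \<open>b\<close>; varying \<open>b\<close> then annihilates its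
  coefficients.\<close>

lemma double_power_sums_independent:
  fixes c :: "nat \<Rightarrow> nat \<Rightarrow> complex"
  assumes "card A = m" "card B = n"
    and z: "\<And>a b. a \<in> A \<Longrightarrow> b \<in> B \<Longrightarrow> (\<Sum>i<m. \<Sum>j<n. c i j * a ^ i * b ^ j) = 0"
    and ij: "i < m" "j < n"
  shows "c i j = 0"
proof (rule power_sums_independent[OF \<open>card B = n\<close> _ ij(2)])
  fix b assume b: "b \<in> B"
  show "(\<Sum>j<n. c i j * b ^ j) = 0"
  proof (rule power_sums_independent[OF \<open>card A = m\<close> _ ij(1), where c = "\<lambda>i. \<Sum>j<n. c i j * b ^ j"])
    fix a assume a: "a \<in> A"
    show "(\<Sum>i<m. (\<Sum>j<n. c i j * b ^ j) * a ^ i) = 0"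
      using z[OF a b] by (simp add: sum_distrib_right sum_distrib_left mult_ac)
  qed
qed

section \<open>Reduction of bivariate polynomials modulo P(x) and Q(y)\<close>

text \<open>A substitute for being a rational polynomial in two variables: one common denominator
  for all integer arguments is what reduction modulo almost all primes requires.\<close>

definition bounded_denominators :: "(int \<Rightarrow> int \<Rightarrow> rat) \<Rightarrow> bool" where
  "bounded_denominators \<phi> \<longleftrightarrow> (\<exists>N::int. N \<noteq> 0 \<and> (\<forall>s t. of_int N * \<phi> s t \<in> \<int>))"

lemma bounded_denominatorsE:
  assumes "bounded_denominators \<phi>"
  obtains N :: int where "N \<noteq> 0" "\<And>s t. of_int N * \<phi> s t \<in> \<int>"
  using assms unfolding bounded_denominators_def by blast

lemma bounded_denominators_of_int [intro]: "bounded_denominators (\<lambda>s t. of_int (f s t))"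
  unfolding bounded_denominators_def by (intro exI[of _ 1]) auto

lemma bounded_denominators_add [intro]:
  assumes "bounded_denominators \<phi>" "bounded_denominators \<psi>"
  shows "bounded_denominators (\<lambda>s t. \<phi> s t + \<psi> s t)"
proof -
  obtain M where M: "M \<noteq> 0" "\<And>s t. of_int M * \<phi> s t \<in> \<int>"
    using assms(1) by (rule bounded_denominatorsE) blast
  obtain N where N: "N \<noteq> 0" "\<And>s t. of_int N * \<psi> s t \<in> \<int>"
    using assms(2) by (rule bounded_denominatorsE) blast
  have "of_int (M * N) * (\<phi> s t + \<psi> s t) \<in> \<int>" for s t
  proof -
    have "of_int (M * N) * (\<phi> s t + \<psi> s t)
        = of_int N * (of_int M * \<phi> s t) + of_int M * (of_int N * \<psi> s t)"
      by (simp add: algebra_simps)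
    also have "\<dots> \<in> \<int>" by (intro Ints_add Ints_mult M N Ints_of_int)
    finally show ?thesis .
  qed
  then show ?thesis unfolding bounded_denominators_def using M N by (intro exI[of _ "M * N"]) auto
qed

lemma bounded_denominators_mult [intro]:
  assumes "bounded_denominators \<phi>" "bounded_denominators \<psi>"
  shows "bounded_denominators (\<lambda>s t. \<phi> s t * \<psi> s t)"
proof -
  obtain M where M: "M \<noteq> 0" "\<And>s t. of_int M * \<phi> s t \<in> \<int>"
    using assms(1) by (rule bounded_denominatorsE) blast
  obtain N where N: "N \<noteq> 0" "\<And>s t. of_int N * \<psi> s t \<in> \<int>"
    using assms(2) by (rule bounded_denominatorsE) blast
  have "of_int (M * N) * (\<phi> s t * \<psi> s t) \<in> \<int>" for s t
  proof -
    have "of_int (M * N) * (\<phi> s t * \<psi> s t) = (of_int M * \<phi> s t) * (of_int N * \<psi> s t)"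
      by simp
    also have "\<dots> \<in> \<int>" by (intro Ints_mult M N)
    finally show ?thesis .
  qed
  then show ?thesis unfolding bounded_denominators_def using M N by (intro exI[of _ "M * N"]) auto
qed

lemma bounded_denominators_poly [intro]:
  "bounded_denominators (\<lambda>s t. poly h (of_int (f s t)))"
proof -
  obtain N F where N: "N \<noteq> 0" and F: "smult (of_int N) h = map_poly (of_int :: int \<Rightarrow> rat) F"
    by (rule rat_poly_clear_denominators)
  have "of_int N * poly h (of_int x) = of_int (poly F x)" for x
    by (metis F poly_smult poly_of_int_poly_of_int)
  then show ?thesis unfolding bounded_denominators_def using N by (intro exI[of _ N]) auto
qed

lemma bounded_denominators_const [intro]: "bounded_denominators (\<lambda>s t. q)"
  using bounded_denominators_poly[of "[:q:]" "\<lambda>s t. 0"] by simp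

text \<open>
  Both F and G stand for the same rational polynomial in two variables, evaluated at pairs of
  complex numbers and at pairs of integers respectively, and T for its remainder modulo P(x) and Q(y).
\<close>
definition reduces_to ::
  "int poly \<Rightarrow> int poly \<Rightarrow> (complex \<Rightarrow> complex \<Rightarrow> complex) \<Rightarrow> (int \<Rightarrow> int \<Rightarrow> rat) \<Rightarrow> (nat \<Rightarrow> nat \<Rightarrow> rat) \<Rightarrow> bool"
where
  "reduces_to P Q F G T \<longleftrightarrow>
     (\<forall>a b. poly (map_poly of_int P) a = 0 \<longrightarrow> poly (map_poly of_int Q) b = 0 \<longrightarrow>
        F a b = (\<Sum>i<degree P. \<Sum>j<degree Q. of_rat (T i j) * a ^ i * b ^ j)) \<and>
     (\<exists>\<phi> \<psi>. bounded_denominators \<phi> \<and> bounded_denominators \<psi> \<and>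
        (\<forall>s t. G s t = (\<Sum>i<degree P. \<Sum>j<degree Q. T i j * of_int s ^ i * of_int t ^ j)
           + of_int (poly P s) * \<phi> s t + of_int (poly Q t) * \<psi> s t))"

lemma reduces_to_0: "reduces_to P Q (\<lambda>a b. 0) (\<lambda>s t. 0) (\<lambda>i j. 0)"
  unfolding reduces_to_def
  by (auto intro!: exI[of _ "\<lambda>s t. 0"])

lemma reduces_to_add:
  assumes "reduces_to P Q F G T" "reduces_to P Q F' G' T'"
  shows "reduces_to P Q (\<lambda>a b. F a b + F' a b) (\<lambda>s t. G s t + G' s t) (\<lambda>i j. T i j + T' i j)"
proof -
  obtain \<phi> \<psi> where 1: "bounded_denominators \<phi>" "bounded_denominators \<psi>"
    "\<And>s t. G s t = (\<Sum>i<degree P. \<Sum>j<degree Q. T i j * of_int s ^ i * of_int t ^ j)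
           + of_int (poly P s) * \<phi> s t + of_int (poly Q t) * \<psi> s t"
    using assms(1) unfolding reduces_to_def by blast
  obtain \<phi>' \<psi>' where 2: "bounded_denominators \<phi>'" "bounded_denominators \<psi>'"
    "\<And>s t. G' s t = (\<Sum>i<degree P. \<Sum>j<degree Q. T' i j * of_int s ^ i * of_int t ^ j)
           + of_int (poly P s) * \<phi>' s t + of_int (poly Q t) * \<psi>' s t"
    using assms(2) unfolding reduces_to_def by blast
  show ?thesis
    unfolding reduces_to_def
  proof (intro conjI allI impI exI)
    show "bounded_denominators (\<lambda>s t. \<phi> s t + \<phi>' s t)" "bounded_denominators (\<lambda>s t. \<psi> s t + \<psi>' s t)"
      using 1 2 by auto
  next
    fix a b :: complex
    assume "poly (map_poly of_int P) a = 0" "poly (map_poly of_int Q) b = 0"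
    then show "F a b + F' a b = (\<Sum>i<degree P. \<Sum>j<degree Q. of_rat (T i j + T' i j) * a ^ i * b ^ j)"
      using assms unfolding reduces_to_def by (simp add: of_rat_add ring_distribs sum.distrib)
  qed (simp add: 1 2 ring_distribs sum.distrib)
qed

lemma reduces_to_scale:
  assumes "reduces_to P Q F G T"
  shows "reduces_to P Q (\<lambda>a b. of_rat q * F a b) (\<lambda>s t. q * G s t) (\<lambda>i j. q * T i j)"
proof -
  obtain \<phi> \<psi> where 1: "bounded_denominators \<phi>" "bounded_denominators \<psi>"
    "\<And>s t. G s t = (\<Sum>i<degree P. \<Sum>j<degree Q. T i j * of_int s ^ i * of_int t ^ j)
           + of_int (poly P s) * \<phi> s t + of_int (poly Q t) * \<psi> s t"
    using assms(1) unfolding reduces_to_def by blast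
  show ?thesis
    unfolding reduces_to_def
  proof (intro conjI allI impI exI)
    show "bounded_denominators (\<lambda>s t. q * \<phi> s t)" "bounded_denominators (\<lambda>s t. q * \<psi> s t)"
      using 1 by auto
  next
    fix a b :: complex
    assume "poly (map_poly of_int P) a = 0" "poly (map_poly of_int Q) b = 0"
    then show "of_rat q * F a b = (\<Sum>i<degree P. \<Sum>j<degree Q. of_rat (q * T i j) * a ^ i * b ^ j)"
      using assms unfolding reduces_to_def by (simp add: of_rat_mult sum_distrib_left mult.assoc)
  qed (simp add: 1 ring_distribs sum_distrib_left mult_ac)
qed

lemma reduces_to_sum:
  assumes "finite I" "\<And>i. i \<in> I \<Longrightarrow> reduces_to P Q (F i) (G i) (T i)"
  shows "reduces_to P Q (\<lambda>a b. \<Sum>n\<in>I. F n a b) (\<lambda>s t. \<Sum>n\<in>I. G n s t) (\<lambda>i j. \<Sum>n\<in>I. T n i j)"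
  using assms
proof (induction I)
  case (insert x I)
  then show ?case
    using reduces_to_add[of P Q "F x" "G x" "T x"] by (simp add: sum.insert)
qed (simp add: reduces_to_0)

text \<open>Divide \<open>x ^ u\<close> by P and \<open>y ^ v\<close> by Q over the rationals; the
  product of the two remainders is the reduced form.\<close>

lemma reduces_to_monom:
  fixes P Q :: "int poly"
  assumes "degree P > 0" "degree Q > 0"
  shows "\<exists>T. reduces_to P Q (\<lambda>a b. a ^ u * b ^ v) (\<lambda>s t. of_int s ^ u * of_int t ^ v) T"
proof -
  define p q :: "rat poly" where "p = map_poly of_int P" and "q = map_poly of_int Q"
  have deg: "degree p = degree P" "degree q = degree Q"
    by (simp_all add: p_def q_def degree_map_poly)
  define r e where "r = monom 1 u mod p" and "e = monom 1 u div p"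
  define r' e' where "r' = monom 1 v mod q" and "e' = monom 1 v div q"
  \<comment> \<open>A zero remainder has degree 0, which is below the bound because the degrees of
    \<open>P\<close> and \<open>Q\<close> are positive.\<close>
  have r: "degree r < degree P" "degree r' < degree Q"
    using assms degree_mod_less'[of p] degree_mod_less'[of q] deg
    by (auto simp: r_def r'_def) (metis degree_0 less_numeral_extra(3))+
  have eq: "monom 1 u = p * e + r" "monom 1 v = q * e' + r'"
    by (simp_all add: r_def e_def r'_def e'_def)
  have evalr: "poly h x = (\<Sum>i<m. coeff h i * x ^ i)" if "degree h < m" for h :: "rat poly" and m x
    unfolding poly_altdef using that by (intro sum.mono_neutral_left) (auto simp: coeff_eq_0)
  have c1: "a ^ u = rat_poly_eval r a" if "poly (map_poly of_int P) a = 0" for a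
    using arg_cong[OF eq(1), of "\<lambda>h. rat_poly_eval h a"] that by (simp add: p_def)
  have c2: "b ^ v = rat_poly_eval r' b" if "poly (map_poly of_int Q) b = 0" for b
    using arg_cong[OF eq(2), of "\<lambda>h. rat_poly_eval h b"] that by (simp add: q_def)
  have i1: "of_int s ^ u = of_int (poly P s) * poly e (of_int s) + poly r (of_int s)" for s
    using arg_cong[OF eq(1), of "\<lambda>h. poly h (of_int s)"]
    by (simp add: p_def poly_of_int_poly_of_int poly_monom)
  have i2: "of_int t ^ v = of_int (poly Q t) * poly e' (of_int t) + poly r' (of_int t)" for t
    using arg_cong[OF eq(2), of "\<lambda>h. poly h (of_int t)"]
    by (simp add: q_def poly_of_int_poly_of_int poly_monom)
  have "reduces_to P Q (\<lambda>a b. a ^ u * b ^ v) (\<lambda>s t. of_int s ^ u * of_int t ^ v)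
          (\<lambda>i j. coeff r i * coeff r' j)"
    unfolding reduces_to_def
  proof (intro conjI allI impI exI)
    fix a b :: complex
    assume "poly (map_poly of_int P) a = 0" "poly (map_poly of_int Q) b = 0"
    then show "a ^ u * b ^ v
        = (\<Sum>i<degree P. \<Sum>j<degree Q. of_rat (coeff r i * coeff r' j) * a ^ i * b ^ j)"
      by (simp add: c1 c2 rat_poly_eval_altdef[OF r(1)] rat_poly_eval_altdef[OF r(2)]
          sum_product of_rat_mult mult_ac)
  next
    \<comment> \<open>The cofactors come from expanding \<open>(p * e + r) * y ^ v\<close> and then
      \<open>r * (q * e' + r')\<close>.\<close>
    show "bounded_denominators (\<lambda>s t. poly e (of_int s) * of_int (t ^ v))"
      by (intro bounded_denominators_mult bounded_denominators_poly bounded_denominators_of_int)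
    show "bounded_denominators (\<lambda>s t. poly r (of_int s) * poly e' (of_int t))"
      by (intro bounded_denominators_mult bounded_denominators_poly)
    fix s t
    have "(\<Sum>i<degree P. \<Sum>j<degree Q. coeff r i * coeff r' j * of_int s ^ i * of_int t ^ j)
        = poly r (of_int s) * poly r' (of_int t)"
      unfolding evalr[OF r(1)] evalr[OF r(2)] sum_product by (intro sum.cong refl) (simp add: mult_ac)
    then show "of_int s ^ u * of_int t ^ v
      = (\<Sum>i<degree P. \<Sum>j<degree Q. coeff r i * coeff r' j * of_int s ^ i * of_int t ^ j)
        + of_int (poly P s) * (poly e (of_int s) * of_int (t ^ v))
        + of_int (poly Q t) * (poly r (of_int s) * poly e' (of_int t))"
      by (simp add: i1 i2 algebra_simps)
  qed
  then show ?thesis by blast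
qed

text \<open>Binomial expansion. The coefficients \<open>T\<close> are the rational coordinates of
  powers of \<open>a + k b\<close> in the monomials, needed both for the descent to rational
  polynomials and for reducing \<open>D (x + k y)\<close>.\<close>

lemma reduces_to_power:
  fixes P Q :: "int poly"
  assumes "degree P > 0" "degree Q > 0"
  shows "\<exists>T. reduces_to P Q (\<lambda>a b. (a + of_int k * b) ^ n) (\<lambda>s t. of_int (s + k * t) ^ n) T"
proof -
  obtain M where M: "\<And>u v. reduces_to P Q (\<lambda>a b. a ^ u * b ^ v) (\<lambda>s t. of_int s ^ u * of_int t ^ v) (M u v)"
    using reduces_to_monom[OF assms] by metis
  define c :: "nat \<Rightarrow> rat" where "c l = of_nat (n choose l) * of_int k ^ (n - l)" for l
  have "reduces_to P Q (\<lambda>a b. \<Sum>l\<le>n. of_rat (c l) * (a ^ l * b ^ (n - l)))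
      (\<lambda>s t. \<Sum>l\<le>n. c l * (of_int s ^ l * of_int t ^ (n - l))) (\<lambda>i j. \<Sum>l\<le>n. c l * M l (n - l) i j)"
    by (intro reduces_to_sum reduces_to_scale M) simp
  moreover have "(\<lambda>a b. \<Sum>l\<le>n. of_rat (c l) * (a ^ l * b ^ (n - l))) = (\<lambda>a b :: complex. (a + of_int k * b) ^ n)"
    by (intro ext) (simp add: binomial_ring c_def of_rat_mult of_rat_power power_mult_distrib mult_ac)
  moreover have "(\<lambda>s t. \<Sum>l\<le>n. c l * (of_int s ^ l * of_int t ^ (n - l))) = (\<lambda>s t. of_int (s + k * t) ^ n)"
    by (intro ext) (simp add: binomial_ring c_def power_mult_distrib mult_ac)
  ultimately show ?thesis by auto
qed

section \<open>Intersections\<close>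

text \<open>
  The monomials a^i b^j with i < deg P and j < deg Q are linearly independent on the grid of root
  pairs, so h(a + k b) = F(a, b) is a linear system with rational coefficients for the
  coefficients of h, and applying the functional l to a complex solution gives a rational one.
\<close>
lemma rational_descent:
  fixes P Q :: "int poly" and h :: "complex poly"
  assumes deg: "degree P > 0" "degree Q > 0"
    and card: "card {a :: complex. poly (map_poly of_int P) a = 0} = degree P"
      "card {b :: complex. poly (map_poly of_int Q) b = 0} = degree Q"
    and l: "\<And>x y. l (x + y) = l x + l y" "\<And>q x. l (of_rat q * x) = q * l x" "l 1 = (1 :: rat)"
    and F: "reduces_to P Q F G T"
    and h: "\<And>a b. poly (map_poly of_int P) a = 0 \<Longrightarrow> poly (map_poly of_int Q) b = 0 \<Longrightarrow>
              poly h (a + of_int k * b) = F a b"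
    and ab: "poly (map_poly of_int P) a = 0" "poly (map_poly of_int Q) b = 0"
  shows "rat_poly_eval (map_poly l h) (a + of_int k * b) = F a b"
proof -
  let ?m = "degree P" and ?n = "degree Q" and ?d = "degree h"
  obtain E where "\<And>n. reduces_to P Q (\<lambda>a b. (a + of_int k * b) ^ n) (\<lambda>s t. of_int (s + k * t) ^ n) (E n)"
    using reduces_to_power[OF deg, of k] by metis
  then have E: "(a + of_int k * b) ^ n = (\<Sum>i<?m. \<Sum>j<?n. of_rat (E n i j) * a ^ i * b ^ j)"
    if "poly (map_poly of_int P) a = 0" "poly (map_poly of_int Q) b = 0" for a b :: complex and n
    using that unfolding reduces_to_def by blast
  have T: "F a b = (\<Sum>i<?m. \<Sum>j<?n. of_rat (T i j) * a ^ i * b ^ j)"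
    if "poly (map_poly of_int P) a = 0" "poly (map_poly of_int Q) b = 0" for a b
    using F that unfolding reduces_to_def by blast
  have swap: "(\<Sum>n\<le>?d. w n * (\<Sum>i<?m. \<Sum>j<?n. of_rat (E n i j) * a ^ i * b ^ j))
      = (\<Sum>i<?m. \<Sum>j<?n. (\<Sum>n\<le>?d. w n * of_rat (E n i j)) * a ^ i * b ^ j)" for w and a b :: complex
  proof -
    have "(\<Sum>n\<le>?d. w n * (\<Sum>i<?m. \<Sum>j<?n. of_rat (E n i j) * a ^ i * b ^ j))
      = (\<Sum>n\<le>?d. \<Sum>i<?m. \<Sum>j<?n. w n * of_rat (E n i j) * a ^ i * b ^ j)"
      by (simp add: sum_distrib_left mult.assoc)
    also have "\<dots> = (\<Sum>i<?m. \<Sum>j<?n. \<Sum>n\<le>?d. w n * of_rat (E n i j) * a ^ i * b ^ j)"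
      by (subst sum.swap) (intro sum.cong refl sum.swap)
    finally show ?thesis by (simp add: sum_distrib_right)
  qed
  have l0: "l 0 = 0" using l(1)[of 0 0] by simp
  have lrat: "l (of_rat q) = q" for q using l(2)[of q 1] l(3) by simp
  have lsum: "l (\<Sum>x\<in>X. f x) = (\<Sum>x\<in>X. l (f x))" if "finite X" for f and X :: "nat set"
    using that by (induction X) (simp_all add: l0 l(1))
  \<comment> \<open>Independence turns agreement on the grid into a complex equation for each
    coefficient; since \<open>E\<close> and \<open>T\<close> are rational, \<open>l\<close> passes
    through to the \<open>coeff h n\<close>.\<close>
  have coeffs: "(\<Sum>n\<le>?d. l (coeff h n) * E n i j) = T i j" if ij: "i < ?m" "j < ?n" for i j
  proof -
    have "(\<Sum>n\<le>?d. coeff h n * of_rat (E n i j)) - of_rat (T i j) = 0"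
    proof (rule double_power_sums_independent[OF card _ ij,
          where c = "\<lambda>i j. (\<Sum>n\<le>?d. coeff h n * of_rat (E n i j)) - of_rat (T i j)"])
      fix a b :: complex
      assume "a \<in> {a. poly (map_poly of_int P) a = 0}" "b \<in> {b. poly (map_poly of_int Q) b = 0}"
      then have ab: "poly (map_poly of_int P) a = 0" "poly (map_poly of_int Q) b = 0" by auto
      have "(\<Sum>i<?m. \<Sum>j<?n. (\<Sum>n\<le>?d. coeff h n * of_rat (E n i j)) * a ^ i * b ^ j)
          = (\<Sum>i<?m. \<Sum>j<?n. of_rat (T i j) * a ^ i * b ^ j)"
        using h[OF ab] unfolding T[OF ab] poly_altdef E[OF ab] swap .
      then show "(\<Sum>i<?m. \<Sum>j<?n. ((\<Sum>n\<le>?d. coeff h n * of_rat (E n i j)) - of_rat (T i j)) * a ^ i * b ^ j) = 0"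
        by (simp add: left_diff_distrib sum_subtractf)
    qed
    then have "l (\<Sum>n\<le>?d. of_rat (E n i j) * coeff h n) = l (of_rat (T i j))"
      by (simp add: mult.commute)
    then show ?thesis by (simp add: lsum l(2) lrat mult.commute[of "l _"])
  qed
  \<comment> \<open>The summation bound is taken from \<open>h\<close>, because \<open>l\<close> may
    kill its leading coefficient.\<close>
  have "rat_poly_eval (map_poly l h) (a + of_int k * b)
      = (\<Sum>n<Suc ?d. of_rat (coeff (map_poly l h) n) * (a + of_int k * b) ^ n)"
    by (intro rat_poly_eval_altdef le_imp_less_Suc map_poly_degree_leq)
  also have "\<dots> = (\<Sum>n\<le>?d. of_rat (l (coeff h n)) * (a + of_int k * b) ^ n)"
    by (simp only: lessThan_Suc_atMost coeff_map_poly l0)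
  also have "\<dots> = (\<Sum>i<?m. \<Sum>j<?n. (\<Sum>n\<le>?d. of_rat (l (coeff h n)) * of_rat (E n i j)) * a ^ i * b ^ j)"
    unfolding E[OF ab] swap ..
  also have "\<dots> = (\<Sum>i<?m. \<Sum>j<?n. of_rat (\<Sum>n\<le>?d. l (coeff h n) * E n i j) * a ^ i * b ^ j)"
    by (simp add: of_rat_sum of_rat_mult)
  also have "\<dots> = F a b"
    unfolding T[OF ab] by (intro sum.cong refl) (simp add: coeffs)
  finally show ?thesis .
qed

section \<open>Transfer of roots modulo p\<close>

text \<open>Expresses that \<open>P\<close> respects the congruence of \<open>u / N\<close> and
  \<open>s\<close> modulo \<open>d\<close>. In the Horner induction each coefficient costs one more
  factor \<open>N\<close> to clear denominators.\<close>

lemma poly_at_fraction_cong: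
  fixes P :: "int poly"
  assumes "d dvd u - N * s" "N \<noteq> 0"
  shows "\<exists>j e. of_int (N ^ j) * (poly (map_poly of_int P) (of_int u / of_int N) - of_int (poly P s))
            = (of_int (d * e) :: rat)"
proof (induction P)
  case 0
  show ?case by (intro exI[of _ 0]) simp
next
  case (pCons c P)
  let ?x = "of_int u / of_int N :: rat"
  obtain j e where je: "of_int (N ^ j) * (poly (map_poly of_int P) ?x - of_int (poly P s))
      = (of_int (d * e) :: rat)" using pCons by blast
  obtain w where w: "u - N * s = d * w" using assms by (elim dvdE)
  have x: "of_int N * ?x = of_int u" using assms by simp
  have "of_int (N ^ Suc j) * (poly (map_poly of_int (pCons c P)) ?x - of_int (poly (pCons c P) s))
     = of_int N * ?x * (of_int (N ^ j) * (poly (map_poly of_int P) ?x - of_int (poly P s)))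
       + of_int (N ^ j) * of_int (poly P s) * (of_int N * ?x - of_int (N * s))"
    by (simp add: map_poly_pCons algebra_simps)
  also have "\<dots> = of_int u * of_int (d * e) + of_int (N ^ j) * of_int (poly P s) * of_int (u - N * s)"
    unfolding je x by simp
  also have "\<dots> = of_int (d * (u * e + N ^ j * poly P s * w))"
    unfolding w by (simp add: algebra_simps)
  finally show ?case by blast
qed

text \<open>If \<open>c\<close> is a root of \<open>D\<close> modulo \<open>p\<close>, then
  \<open>f c\<close> is a root of \<open>P\<close> modulo \<open>p\<close>, provided
  \<open>p\<close> avoids the denominators of \<open>f\<close> and of the cofactor.\<close>

lemma prime_divisors_subset_of_dvd_pcompose:
  fixes P D :: "int poly" and f :: "rat poly"
  assumes "map_poly of_int D dvd pcompose (map_poly of_int P) f"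
  obtains N :: int where "N \<noteq> 0"
    "\<And>p. p \<in> prime_divisors D \<Longrightarrow> \<not> int p dvd N \<Longrightarrow> p \<in> prime_divisors P"
proof -
  obtain E where E: "pcompose (map_poly of_int P) f = map_poly of_int D * E"
    using assms by (elim dvdE)
  obtain M where M: "M \<noteq> 0" "\<And>s. of_int M * poly f (of_int s) \<in> \<int>"
    using bounded_denominators_poly[of f "\<lambda>s t. s"] by (rule bounded_denominatorsE) blast
  obtain L where L: "L \<noteq> 0" "\<And>s. of_int L * poly E (of_int s) \<in> \<int>"
    using bounded_denominators_poly[of E "\<lambda>s t. s"] by (rule bounded_denominatorsE) blast
  have "p \<in> prime_divisors P" if p: "p \<in> prime_divisors D" "\<not> int p dvd M * L" for p
  proof -
    obtain c where c: "int p dvd poly D c" and pr: "prime p"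
      using p by (auto simp: prime_divisors_def)
    have nM: "\<not> int p dvd M" "\<not> int p dvd L" using p by auto
    obtain u where u: "of_int M * poly f (of_int c) = of_int u" using M Ints_cases by metis
    obtain v where v: "of_int L * poly E (of_int c) = of_int v" using L Ints_cases by metis
    have fu: "poly f (of_int c) = of_int u / of_int M"
      using u M by (simp add: field_simps)
    \<comment> \<open>The integer \<open>s\<close> represents the fraction
      \<open>f c = u / M\<close> modulo \<open>p\<close>.\<close>
    obtain s where s: "int p dvd M * s - u"
      using linear_congruence_solvable[OF pr nM(1)] by metis
    then have "int p dvd u - M * s" by (simp add: dvd_diff_commute)
    from poly_at_fraction_cong[OF this M(1), of P] obtain j e where je:
      "of_int (M ^ j) * (poly (map_poly of_int P) (poly f (of_int c)) - of_int (poly P s))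
         = (of_int (int p * e) :: rat)"
      unfolding fu by blast
    have "poly (map_poly of_int P) (poly f (of_int c)) = of_int (poly D c) * poly E (of_int c)"
      using arg_cong[OF E, of "\<lambda>h. poly h (of_int c)"]
      by (simp add: poly_pcompose poly_of_int_poly_of_int)
    then have "of_int L * of_int (M ^ j) * (of_int (poly D c) * poly E (of_int c) - of_int (poly P s))
         = (of_int L * of_int (int p * e) :: rat)"
      using je by simp
    then have "of_int (M ^ j) * of_int (poly D c) * (of_int L * poly E (of_int c))
        = (of_int (L * M ^ j * poly P s + L * int p * e) :: rat)"
      by (simp add: algebra_simps)
    then have "of_int (M ^ j * poly D c * v) = (of_int (L * M ^ j * poly P s + L * int p * e) :: rat)"
      unfolding v by simp
    then have "M ^ j * poly D c * v = L * M ^ j * poly P s + L * int p * e"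
      using of_int_eq_iff by blast
    moreover have "int p dvd M ^ j * poly D c * v" using c by simp
    ultimately have "int p dvd L * M ^ j * poly P s"
      by (metis dvd_add_left_iff dvd_mult2 dvd_mult dvd_refl)
    then have "int p dvd poly P s"
      using pr nM prime_dvd_power[of "int p" M j] by (auto simp: prime_dvd_mult_iff)
    then show ?thesis using pr by (auto simp: prime_divisors_def)
  qed
  then show ?thesis using that[of "M * L"] M L by simp
qed

text \<open>The exceptional primes all come from denominators, which \<open>N\<close> collects: two
  contributions from the maps back to roots of \<open>P\<close> and \<open>Q\<close>, two from the
  ideal representation of \<open>D (x + k y)\<close>.\<close>

lemma prime_divisors_inter_prime_elem:
  fixes P Q :: "int poly"
  assumes P: "prime_elem P" "degree P > 0" and Q: "prime_elem Q" "degree Q > 0"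
  obtains D :: "int poly" and N :: int where "N \<noteq> 0"
    "\<And>p. \<not> int p dvd N \<Longrightarrow> p \<in> prime_divisors D \<longleftrightarrow> p \<in> prime_divisors P \<inter> prime_divisors Q"
proof -
  define A where "A = {a :: complex. poly (map_poly of_int P) a = 0}"
  define B where "B = {b :: complex. poly (map_poly of_int Q) b = 0}"
  note deg = P(2) Q(2)
  note card = card_complex_roots_prime_poly[OF P] card_complex_roots_prime_poly[OF Q]
  have fin: "finite A" "finite B"
    using card deg by (auto simp: A_def B_def intro: card_ge_0_finite)
  obtain k :: int where inj: "inj_on (\<lambda>(a, b). a + of_int k * b) (A \<times> B)"
    using injective_linear_combination[OF fin] .
  define \<Gamma> where "\<Gamma> = (\<lambda>(a, b). a + of_int k * b) ` (A \<times> B)"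
  have "finite \<Gamma>" using fin by (simp add: \<Gamma>_def)
  obtain l :: "complex \<Rightarrow> rat"
    where l: "\<And>x y. l (x + y) = l x + l y" "\<And>q x. l (of_rat q * x) = q * l x" "l 1 = 1"
    using rational_functional_exists by metis
  have l0: "l 0 = 0" using l(1)[of 0 0] by simp
  have descent: "rat_poly_eval (map_poly l h) (a + of_int k * b) = F a b"
    if "reduces_to P Q F G T" "\<And>a b. a \<in> A \<Longrightarrow> b \<in> B \<Longrightarrow> poly h (a + of_int k * b) = F a b"
      "a \<in> A" "b \<in> B" for F G T h a b
    using rational_descent[OF deg card l that(1)] that by (simp add: A_def B_def)
  have interp: "\<exists>f. \<forall>a\<in>A. \<forall>b\<in>B. rat_poly_eval f (a + of_int k * b) = F a b"
    if F: "reduces_to P Q F G T" for F G T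
  proof -
    \<comment> \<open>By injectivity \<open>inv_into\<close> recovers the pair from its combination,
      so \<open>F\<close> becomes a function on \<open>\<Gamma>\<close>.\<close>
    define v where "v = (\<lambda>(a, b). F a b) \<circ> inv_into (A \<times> B) (\<lambda>(a, b). a + of_int k * b)"
    obtain h where h: "\<And>x. x \<in> \<Gamma> \<Longrightarrow> poly h x = v x"
      using interpolation_poly_exists[OF \<open>finite \<Gamma>\<close>] by metis
    have "poly h (a + of_int k * b) = F a b" if "a \<in> A" "b \<in> B" for a b
    proof -
      have "a + of_int k * b \<in> \<Gamma>" using that by (force simp: \<Gamma>_def)
      then show ?thesis using h inv_into_f_f[OF inj, of "(a, b)"] that by (simp add: v_def)
    qed
    then show ?thesis using descent[OF F] by blast
  qed
  \<comment> \<open>The exponents 1, 0 and 0, 1 make the monomial a coordinate projection.\<close>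
  obtain f where f: "\<And>a b. a \<in> A \<Longrightarrow> b \<in> B \<Longrightarrow> rat_poly_eval f (a + of_int k * b) = a"
    using reduces_to_monom[OF deg, of 1 0] interp by fastforce
  obtain g where g: "\<And>a b. a \<in> A \<Longrightarrow> b \<in> B \<Longrightarrow> rat_poly_eval g (a + of_int k * b) = b"
    using reduces_to_monom[OF deg, of 0 1] interp by fastforce
  let ?van = "\<lambda>D. D \<noteq> 0 \<and> (\<forall>x\<in>\<Gamma>. poly (map_poly of_int D) x = 0)"
  have clear: "\<exists>D. ?van D \<and> degree D = degree h"
    if "h \<noteq> 0" "\<And>x. x \<in> \<Gamma> \<Longrightarrow> rat_poly_eval h x = 0" for h
  proof -
    obtain N D where N: "N \<noteq> 0" and D: "smult (of_int N) h = map_poly (of_int :: int \<Rightarrow> rat) D"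
      by (rule rat_poly_clear_denominators)
    have "poly (map_poly of_int D) x = of_int N * rat_poly_eval h x" for x
      using rat_poly_eval_of_int_poly[of D x] by (simp flip: D)
    moreover have "degree D = degree h"
      using arg_cong[OF D, of degree] N by (simp add: degree_map_poly)
    moreover have "D \<noteq> 0" using D N that by auto
    ultimately show ?thesis using that by auto
  qed
  \<comment> \<open>The image under \<open>l\<close> of the monic polynomial with root set
    \<open>\<Gamma>\<close> still vanishes there, by descent with \<open>F = 0\<close>, and is
    nonzero because \<open>l 1 = 1\<close>.\<close>
  have "\<exists>D. ?van D"
  proof -
    define w :: "complex poly" where "w = (\<Prod>x\<in>\<Gamma>. [:-x, 1:])"
    have "lead_coeff w = 1" by (simp add: w_def lead_coeff_prod)
    then have "coeff (map_poly l w) (degree w) = 1" by (simp add: coeff_map_poly l0 l(3))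
    then have nz: "map_poly l w \<noteq> 0" by auto
    have w0: "poly w x = 0" if "x \<in> \<Gamma>" for x
      using that \<open>finite \<Gamma>\<close> by (auto simp: w_def poly_prod)
    have "rat_poly_eval (map_poly l w) (a + of_int k * b) = 0" if "a \<in> A" "b \<in> B" for a b
      by (rule descent[OF reduces_to_0]) (use that w0 in \<open>force simp: \<Gamma>_def\<close>)+
    then have "rat_poly_eval (map_poly l w) x = 0" if "x \<in> \<Gamma>" for x
      using that by (auto simp: \<Gamma>_def)
    then show ?thesis using clear[OF nz] by blast
  qed
  then obtain D where D: "?van D" and least: "\<And>D'. ?van D' \<Longrightarrow> degree D \<le> degree D'"
    using ex_has_least_nat[of ?van _ degree] by blast
  \<comment> \<open>The remainder of \<open>h\<close> modulo \<open>D\<close> also vanishes on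
    \<open>\<Gamma>\<close>; if nonzero, clearing its denominators would contradict the minimal
    degree of \<open>D\<close>.\<close>
  have dvd: "map_poly of_int D dvd h" if h: "\<And>x. x \<in> \<Gamma> \<Longrightarrow> rat_poly_eval h x = 0" for h
  proof (rule ccontr)
    define DQ where "DQ = map_poly (of_int :: int \<Rightarrow> rat) D"
    assume "\<not> map_poly of_int D dvd h"
    then have nz: "h mod DQ \<noteq> 0" by (simp add: DQ_def mod_eq_0_iff_dvd)
    have DQ: "DQ \<noteq> 0" using D by (simp add: DQ_def map_poly_eq_0_iff)
    have "rat_poly_eval (h mod DQ) x = 0" if "x \<in> \<Gamma>" for x
    proof -
      have "rat_poly_eval h x = rat_poly_eval (DQ * (h div DQ) + h mod DQ) x" by simp
      also have "\<dots> = rat_poly_eval (h mod DQ) x"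
        unfolding rat_poly_eval_add rat_poly_eval_mult using D that by (simp add: DQ_def)
      finally show ?thesis using h[OF that] by simp
    qed
    then obtain D' where "?van D'" "degree D' = degree (h mod DQ)" using clear[OF nz] by blast
    then have "degree D \<le> degree (h mod DQ)" using least by metis
    then show False
      using degree_mod_less'[OF DQ nz] by (simp add: DQ_def degree_map_poly)
  qed
  \<comment> \<open>On \<open>\<Gamma>\<close> the composition takes the values
    \<open>P a = 0\<close>.\<close>
  have "map_poly of_int D dvd pcompose (map_poly of_int P) f"
    by (intro dvd) (auto simp: \<Gamma>_def f A_def B_def f[unfolded A_def B_def])
  then obtain N1 where N1: "N1 \<noteq> 0"
    "\<And>p. p \<in> prime_divisors D \<Longrightarrow> \<not> int p dvd N1 \<Longrightarrow> p \<in> prime_divisors P"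
    by (rule prime_divisors_subset_of_dvd_pcompose) metis
  have "map_poly of_int D dvd pcompose (map_poly of_int Q) g"
    by (intro dvd) (auto simp: \<Gamma>_def A_def B_def g[unfolded A_def B_def])
  then obtain N2 where N2: "N2 \<noteq> 0"
    "\<And>p. p \<in> prime_divisors D \<Longrightarrow> \<not> int p dvd N2 \<Longrightarrow> p \<in> prime_divisors Q"
    by (rule prime_divisors_subset_of_dvd_pcompose) metis

  obtain E where E: "\<And>n. reduces_to P Q (\<lambda>a b. (a + of_int k * b) ^ n) (\<lambda>s t. of_int (s + k * t) ^ n) (E n)"
    using reduces_to_power[OF deg, of k] by metis
  define T where "T i j = (\<Sum>n\<le>degree D. of_int (coeff D n) * E n i j)" for i j
  have "reduces_to P Q (\<lambda>a b. \<Sum>n\<le>degree D. of_rat (of_int (coeff D n)) * (a + of_int k * b) ^ n)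
      (\<lambda>s t. \<Sum>n\<le>degree D. of_int (coeff D n) * of_int (s + k * t) ^ n) T"
    unfolding T_def by (intro reduces_to_sum reduces_to_scale E) simp
  moreover have "(\<lambda>a b. \<Sum>n\<le>degree D. of_rat (of_int (coeff D n)) * (a + of_int k * b) ^ n)
      = (\<lambda>a b. poly (map_poly of_int D) (a + of_int k * b) :: complex)"
    by (simp add: poly_altdef degree_map_poly coeff_map_poly)
  moreover have "(\<lambda>s t. \<Sum>n\<le>degree D. of_int (coeff D n) * of_int (s + k * t) ^ n)
      = (\<lambda>s t. of_int (poly D (s + k * t)) :: rat)"
    by (simp add: poly_altdef)
  ultimately have red: "reduces_to P Q (\<lambda>a b. poly (map_poly of_int D) (a + of_int k * b))
      (\<lambda>s t. of_int (poly D (s + k * t))) T" by simp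
  \<comment> \<open>The reduced form of \<open>D (x + k y)\<close> vanishes on the whole grid of
    root pairs, so independence leaves only the multiples of \<open>P\<close> and
    \<open>Q\<close>.\<close>
  have T0: "T i j = 0" if ij: "i < degree P" "j < degree Q" for i j
  proof -
    have "(of_rat (T i j) :: complex) = 0"
    proof (rule double_power_sums_independent[OF card _ ij, where c = "\<lambda>i j. of_rat (T i j)"])
      fix a b :: complex
      assume "a \<in> {a. poly (map_poly of_int P) a = 0}" "b \<in> {b. poly (map_poly of_int Q) b = 0}"
      moreover from this have "a + of_int k * b \<in> \<Gamma>" by (force simp: \<Gamma>_def A_def B_def)
      ultimately show "(\<Sum>i<degree P. \<Sum>j<degree Q. of_rat (T i j) * a ^ i * b ^ j) = 0"
        using red D unfolding reduces_to_def by auto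
    qed
    then show ?thesis by simp
  qed
  obtain \<phi> \<psi> where bd: "bounded_denominators \<phi>" "bounded_denominators \<psi>" and
    "\<And>s t. of_int (poly D (s + k * t)) = (\<Sum>i<degree P. \<Sum>j<degree Q. T i j * of_int s ^ i * of_int t ^ j)
           + of_int (poly P s) * \<phi> s t + of_int (poly Q t) * \<psi> s t"
    using red unfolding reduces_to_def by blast
  then have Dst: "of_int (poly D (s + k * t)) = of_int (poly P s) * \<phi> s t + of_int (poly Q t) * \<psi> s t" for s t
    by (simp add: T0)
  obtain N3 where N3: "N3 \<noteq> 0" "\<And>s t. of_int N3 * \<phi> s t \<in> \<int>"
    using bd(1) by (rule bounded_denominatorsE) blast
  obtain N4 where N4: "N4 \<noteq> 0" "\<And>s t. of_int N4 * \<psi> s t \<in> \<int>"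
    using bd(2) by (rule bounded_denominatorsE) blast
  \<comment> \<open>Roots \<open>s\<close> and \<open>t\<close> modulo \<open>p\<close> make both
    terms of \<open>Dst\<close> vanish once the denominators \<open>N3\<close> and \<open>N4\<close>
    are invertible.\<close>
  have inD: "p \<in> prime_divisors D"
    if p: "p \<in> prime_divisors P" "p \<in> prime_divisors Q" "\<not> int p dvd N3 * N4" for p
  proof -
    obtain s t where st: "int p dvd poly P s" "int p dvd poly Q t" and pr: "prime p"
      using p by (auto simp: prime_divisors_def)
    obtain u where u: "of_int N3 * \<phi> s t = of_int u" using N3 Ints_cases by metis
    obtain v where v: "of_int N4 * \<psi> s t = of_int v" using N4 Ints_cases by metis
    have "(of_int (N3 * N4 * poly D (s + k * t)) :: rat)
        = of_int N4 * of_int (poly P s) * (of_int N3 * \<phi> s t)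
          + of_int N3 * of_int (poly Q t) * (of_int N4 * \<psi> s t)"
      by (simp add: Dst algebra_simps del: of_int_add)
    also have "\<dots> = of_int (N4 * poly P s * u + N3 * poly Q t * v)"
      unfolding u v by simp
    finally have "N3 * N4 * poly D (s + k * t) = N4 * poly P s * u + N3 * poly Q t * v"
      using of_int_eq_iff by blast
    then have "int p dvd N3 * N4 * poly D (s + k * t)" using st by simp
    then have "int p dvd poly D (s + k * t)"
      using p(3) pr prime_dvd_multD by (metis prime_nat_int_transfer)
    then show ?thesis using pr by (auto simp: prime_divisors_def)
  qed
  have sub: "int p dvd N1 * N2 * (N3 * N4)" if "int p dvd N1 \<or> int p dvd N2 \<or> int p dvd N3 * N4" for p
    using that by (auto intro: dvd_mult dvd_mult2)
  show ?thesis
  proof (rule that[of "N1 * N2 * (N3 * N4)" D])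
    show "N1 * N2 * (N3 * N4) \<noteq> 0" using N1 N2 N3 N4 by simp
    show "p \<in> prime_divisors D \<longleftrightarrow> p \<in> prime_divisors P \<inter> prime_divisors Q"
      if "\<not> int p dvd N1 * N2 * (N3 * N4)" for p
      using that sub[of p] N1(2)[of p] N2(2)[of p] inD[of p] by blast
  qed
qed

section \<open>From prime factors to arbitrary polynomials\<close>

lemma prime_divisors_inter_primes:
  fixes P Q :: "int poly"
  assumes P: "prime P" and Q: "prime Q"
  shows "\<exists>D. prime_divisors D = prime_divisors P \<inter> prime_divisors Q"
proof -
  have fin: "finite (prime_divisors R)" if "prime R" "degree R = 0" for R :: "int poly"
  proof -
    obtain c where c: "R = [:c:]" using \<open>degree R = 0\<close> by (rule degree_eq_zeroE)
    then have "c \<noteq> 0" using \<open>prime R\<close> by auto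
    then show ?thesis unfolding c prime_divisors_const by (rule finite_prime_divisors_const)
  qed
  have sub: "prime_divisors P \<inter> prime_divisors Q \<subseteq> {p. prime p}"
    by (auto simp: prime_divisors_def)
  consider "degree P = 0 \<or> degree Q = 0" | "degree P > 0" "degree Q > 0" by blast
  then have "\<exists>D. finite {p. \<not> (p \<in> prime_divisors D \<longleftrightarrow> p \<in> prime_divisors P \<inter> prime_divisors Q)}"
  proof cases
    case 1
    then have "finite (prime_divisors P \<inter> prime_divisors Q)" using fin P Q by auto
    \<comment> \<open>The constant 1 has no prime divisors, so a finite intersection is a finite
      modification of its set.\<close>
    then have "finite {p. \<not> (p \<in> prime_divisors 1 \<longleftrightarrow> p \<in> prime_divisors P \<inter> prime_divisors Q)}"
      by (rule rev_finite_subset) (auto simp: prime_divisors_def)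
    then show ?thesis by blast
  next
    case 2
    obtain D :: "int poly" and N :: int where N: "N \<noteq> 0" and
      D: "\<And>p. \<not> int p dvd N \<Longrightarrow> p \<in> prime_divisors D \<longleftrightarrow> p \<in> prime_divisors P \<inter> prime_divisors Q"
      using prime_divisors_inter_prime_elem[of P Q] P Q 2 by (metis prime_imp_prime_elem)
    have "{p. \<not> (p \<in> prime_divisors D \<longleftrightarrow> p \<in> prime_divisors P \<inter> prime_divisors Q)}
        \<subseteq> {p. prime p \<and> int p dvd N}"
      using D by (auto simp: prime_divisors_def)
    then show ?thesis using finite_prime_divisors_const[OF N] finite_subset by blast
  qed
  then show ?thesis using prime_divisors_finite_modification[OF sub] by metis
qed

lemma prime_divisors_unit: "is_unit P \<Longrightarrow> prime_divisors P = {}"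
proof -
  assume "is_unit P"
  then obtain c where c: "P = [:c:]" "c dvd 1" by (auto simp: is_unit_poly_iff)
  have "\<not> int p dvd c" if "prime p" for p
    using c(2) that dvd_trans not_prime_unit by (metis prime_nat_int_transfer)
  then show ?thesis by (auto simp: c prime_divisors_const)
qed

text \<open>Intersection distributes over the union that a product yields, so prime factors are
  split off first from \<open>P\<close>, then from \<open>Q\<close>, and the partial results are
  multiplied.\<close>

lemma prime_divisors_inter:
  "\<exists>D. prime_divisors D = prime_divisors P \<inter> prime_divisors Q"
\<comment> \<open>Despite its name this rule is not about the constant
  \<open>prime_divisors\<close>: it is induction over prime factorizations, with cases for zero,
  units and a further prime factor.\<close>
proof (induction P rule: prime_divisors_induct)
  case zero
  show ?case by (intro exI[of _ Q]) (auto simp: prime_divisors_0 prime_divisors_def)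
next
  case (unit P)
  then show ?case using prime_divisors_unit by blast
next
  case (factor R P)
  have "\<exists>D. prime_divisors D = prime_divisors R \<inter> prime_divisors Q"
  proof (induction Q rule: prime_divisors_induct)
    case zero
    show ?case by (intro exI[of _ R]) (auto simp: prime_divisors_0 prime_divisors_def)
  next
    case (unit Q)
    then show ?case using prime_divisors_unit by blast
  next
    case (factor R' Q)
    then show ?case
      using prime_divisors_inter_primes[OF \<open>prime R\<close> \<open>prime R'\<close>]
      by (metis prime_divisors_mult Int_Un_distrib)
  qed
  with factor show ?case by (metis prime_divisors_mult Int_Un_distrib2)
qed

theorem theorem1:
  fixes n :: nat and P :: "nat \<Rightarrow> int poly"
  assumes "n \<ge> 1"
  shows "\<exists>D :: int poly. prime_divisors D = (\<Inter>i\<in>{1..n}. prime_divisors (P i))"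
  using assms
proof (induction n rule: dec_induct)
  case base
  show ?case by auto
next
  case (step n)
  then obtain D where "prime_divisors D = (\<Inter>i\<in>{1..n}. prime_divisors (P i))" by blast
  moreover have "{1..Suc n} = insert (Suc n) {1..n}" by auto
  ultimately show ?case using prime_divisors_inter[of "P (Suc n)" D] by simp
qed

end
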